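(* Let $(G,D,\Delta)$ be an instance of DiTTR, $G=(V,E)$, with $D_{u,v}=\hat d(u,v)$ for all $u,v\in V$. Then $(G,D,\Delta)$ is realizable if and only if for any pair of branching vertices $y,z$ of $G$ the distance $\hat d(y,z)$ is an integer multiple of $\Delta/2$.
   Context: All graphs are finite. A $\Delta$-periodic labeling of a directed graph $G=(V,E)$ is a map $\lambda:E\to\{0,1,\dots,\Delta-1\}$; edge $e$ is then active exactly at the times $\lambda(e)+i\Delta$, $i\in\mathbb{N}_0$. A temporal $s$-$z$-path is a sequence $(v_{i-1},v_i,t_i)_{i=1}^{\ell}$ with $v_0=s$, $v_\ell=z$, pairwise distinct vertices $v_0,\dots,v_\ell$, $(v_{i-1},v_i)\in E$ active at time $t_i$ for every $i$, and $t_1<t_2<\dots<t_\ell$ (strictly increasing). Its duration is $t_\ell+1-t_1$. A fastest temporal path is one of minimum duration. $\hat d(u,v)$ is the distance from $u$ to $v$ in the static graph $G$ (all edges have unit length). A bidirected tree is the directed graph obtained from an undirected tree by replacing each edge $\{u,v\}$ by the two directed edges $(u,v),(v,u)$ (which may get different labels). A branching vertex is a vertex whose total degree (indegree plus outdegree) in the bidirected tree is at least $6$. An instance of DiTTR is a triple $(G,D,\Delta)$ with $G=(V,E)$ a bidirected tree, $D$ a matrix indexed by $V\times V$ with entries positive integers or $\infty$ (no restriction) such that $D_{u,v}\ge \hat d(u,v)$ for all $u,v$, and $\Delta$ a positive integer. It is realizable (feasible) if there is a $\Delta$-periodic labeling $\lambda$ of $E$ such that, for all $u,v\in V$, the duration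 of a fastest temporal path from $u$ to $v$ is at most $D_{u,v}$. Diagonal entries of $D$ play no role; all conditions on $D$ are for distinct vertices. *)

theory Defs
  imports "Graph_Theory.Graph_Theory"
begin

text \<open>
  The library's notion of a graph is used for undirected simple graphs: \<^locale>\<open>pair_graph\<close> is
  a finite loop-free symmetric digraph without parallel arcs, i.e. a finite undirected simple
  graph with each edge replaced by its two orientations.  The library constant \<^const>\<open>tree\<close>
  forbids all directed cycles, including u, v, u, and therefore does not apply to symmetric
  digraphs; the cycles of the underlying undirected graph are the directed cycles of length at
  least 3.
\<close>

definition bidirected_tree :: "'a pair_pre_digraph \<Rightarrow> bool" where
  "bidirected_tree G \<longleftrightarrow>
     pair_graph G \<and> connected (with_proj G) \<and>
     \<not> (\<exists>p. pre_digraph.cycle (with_proj G) p \<and> length p \<ge> 3)"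

definition branching_vertex :: "'a pair_pre_digraph \<Rightarrow> 'a \<Rightarrow> bool" where
  "branching_vertex G v \<longleftrightarrow>
     v \<in> pverts G \<and> in_degree (with_proj G) v + out_degree (with_proj G) v \<ge> 6"

definition static_dist :: "'a pair_pre_digraph \<Rightarrow> 'a \<Rightarrow> 'a \<Rightarrow> ereal" where
  "static_dist G u v = wf_digraph.\<mu> (with_proj G) (\<lambda>_. 1) u v"

definition periodic_labeling :: "'a pair_pre_digraph \<Rightarrow> nat \<Rightarrow> ('a \<times> 'a \<Rightarrow> nat) \<Rightarrow> bool" where
  "periodic_labeling G \<Delta> lab \<longleftrightarrow> (\<forall>e \<in> parcs G. lab e < \<Delta>)"

definition active_at :: "nat \<Rightarrow> ('a \<times> 'a \<Rightarrow> nat) \<Rightarrow> 'a \<times> 'a \<Rightarrow> nat \<Rightarrow> bool" where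
  "active_at \<Delta> lab e t \<longleftrightarrow> (\<exists>i. t = lab e + i * \<Delta>)"

text \<open>
  A temporal path is a list of entries ((v', v), t): the arc traversed and the time of traversal.
  It is required to be non-empty because the duration of an empty path is undefined.
\<close>

definition temporal_path ::
  "'a pair_pre_digraph \<Rightarrow> nat \<Rightarrow> ('a \<times> 'a \<Rightarrow> nat) \<Rightarrow> 'a \<Rightarrow> (('a \<times> 'a) \<times> nat) list \<Rightarrow> 'a \<Rightarrow> bool" where
  "temporal_path G \<Delta> lab s P z \<longleftrightarrow>
     P \<noteq> [] \<and>
     pre_digraph.apath (with_proj G) s (map fst P) z \<and>
     (\<forall>(e, t) \<in> set P. active_at \<Delta> lab e t) \<and>
     sorted_wrt (<) (map snd P)"

definition duration :: "(('a \<times> 'a) \<times> nat) list \<Rightarrow> nat" where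
  "duration P = snd (last P) + 1 - snd (hd P)"

text \<open>The infimum in \<^typ>\<open>enat\<close> is a minimum if a temporal path exists, and \<open>\<infinity>\<close> otherwise.\<close>

definition fastest_duration ::
  "'a pair_pre_digraph \<Rightarrow> nat \<Rightarrow> ('a \<times> 'a \<Rightarrow> nat) \<Rightarrow> 'a \<Rightarrow> 'a \<Rightarrow> enat" where
  "fastest_duration G \<Delta> lab u v =
     (INF P \<in> {P. temporal_path G \<Delta> lab u P v}. enat (duration P))"

definition dittr_instance :: "'a pair_pre_digraph \<Rightarrow> ('a \<Rightarrow> 'a \<Rightarrow> enat) \<Rightarrow> nat \<Rightarrow> bool" where
  "dittr_instance G D \<Delta> \<longleftrightarrow>
     bidirected_tree G \<and> \<Delta> > 0 \<and>
     (\<forall>u \<in> pverts G. \<forall>v \<in> pverts G. u \<noteq> v \<longrightarrow>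
        D u v > 0 \<and> ereal_of_enat (D u v) \<ge> static_dist G u v)"

definition realizable :: "'a pair_pre_digraph \<Rightarrow> ('a \<Rightarrow> 'a \<Rightarrow> enat) \<Rightarrow> nat \<Rightarrow> bool" where
  "realizable G D \<Delta> \<longleftrightarrow>
     (\<exists>lab. periodic_labeling G \<Delta> lab \<and>
        (\<forall>u \<in> pverts G. \<forall>v \<in> pverts G. u \<noteq> v \<longrightarrow> fastest_duration G \<Delta> lab u v \<le> D u v))"

end

theory Submission
  imports Defs "HOL-Number_Theory.Cong"
begin

text \<open>
  In a tree, durations equal to static distances mean that every path can be traversed without
  waiting, i.e. that the labels increase by 1 modulo \<open>\<Delta>\<close> at each turn-free step. At a vertex with
  three neighbours this forces all outgoing labels to exceed all incoming ones by 1, so going from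
  one branching vertex to another and back yields \<open>\<Delta> dvd 2 * d\<close>. Conversely, root the tree at a
  branching vertex \<open>r\<close> (at any vertex if there is none), and give each arc the depth of its head,
  negated for arcs pointing towards \<open>r\<close>. The only critical step is one from a child to
  another child of \<open>b\<close>, where the labels must satisfy \<open>d b + 1 = - d b + 1\<close>; either \<open>b = r\<close>, or \<open>b\<close>
  has a parent and two children and hence is branching.
\<close>

section \<open>Durations and activity times\<close>

lemma sorted_wrt_less_last:
  fixes xs :: "nat list"
  assumes "sorted_wrt (<) xs" "xs \<noteq> []"
  shows "hd xs + length xs \<le> Suc (last xs)"
  using assms
proof (induction xs)
  case (Cons x xs)
  then show ?case by (cases xs) auto
qed simp

text \<open>If every value exceeded \<open>n\<close>, or if there were no value at all, then
  \<open>Suc n\<close> would be a lower bound.\<close>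

lemma INF_enat_le_iff:
  fixes f :: "'b \<Rightarrow> nat"
  shows "(INF x \<in> A. enat (f x)) \<le> enat n \<longleftrightarrow> (\<exists>x \<in> A. f x \<le> n)"
proof
  assume le: "(INF x \<in> A. enat (f x)) \<le> enat n"
  show "\<exists>x \<in> A. f x \<le> n"
  proof (rule ccontr)
    assume "\<not> (\<exists>x \<in> A. f x \<le> n)"
    then have "enat (Suc n) \<le> (INF x \<in> A. enat (f x))"
      by (intro INF_greatest) (auto simp: not_le Suc_le_eq)
    with le have "enat (Suc n) \<le> enat n" by (rule order_trans[rotated])
    then show False by simp
  qed
next
  assume "\<exists>x \<in> A. f x \<le> n"
  then show "(INF x \<in> A. enat (f x)) \<le> enat n" by (auto intro: INF_lower2)
qed

lemma fastest_duration_le_iff: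
  "fastest_duration G \<Delta> lab u v \<le> enat n \<longleftrightarrow> (\<exists>P. temporal_path G \<Delta> lab u P v \<and> duration P \<le> n)"
  unfolding fastest_duration_def by (simp add: INF_enat_le_iff)

text \<open>The times along a path are strictly increasing naturals, so every arc takes up a time
  unit of its own.\<close>

lemma length_le_duration:
  assumes "temporal_path G \<Delta> lab u P v"
  shows "length P \<le> duration P"
proof -
  have "P \<noteq> []" "sorted_wrt (<) (map snd P)"
    using assms by (auto simp: temporal_path_def)
  with sorted_wrt_less_last[of "map snd P"] show ?thesis
    by (auto simp: duration_def hd_map last_map)
qed

text \<open>A label below \<open>\<Delta>\<close> is the least natural in its residue class, so the
  active times fill the whole class.\<close>

lemma active_at_iff:
  assumes "lab e < \<Delta>"
  shows "active_at \<Delta> lab e t \<longleftrightarrow> [lab e = t] (mod \<Delta>)"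
proof -
  have "t mod \<Delta> = lab e" if "t = lab e + i * \<Delta>" for i
    using assms that by simp
  moreover have "t = lab e + t div \<Delta> * \<Delta>" if "t mod \<Delta> = lab e"
    using that by (metis add.commute div_mult_mod_eq)
  ultimately have "active_at \<Delta> lab e t \<longleftrightarrow> t mod \<Delta> = lab e"
    unfolding active_at_def by blast
  then show ?thesis
    using assms by (auto simp: cong_def)
qed

section \<open>Distances in bidirected trees\<close>

locale bidir_tree = pair_graph +
  assumes strongly_connected: "strongly_connected (with_proj G)"
    and cycle_length: "cycle p \<Longrightarrow> length p < 3"

text \<open>Symmetry of the arcs turns connectivity into strong connectivity, which supplies
  directed walks between any two vertices.\<close>

lemma bidirected_tree_bidir_tree:
  assumes "bidirected_tree G"
  shows "bidir_tree G"
proof -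
  interpret pair_graph G using assms by (simp add: bidirected_tree_def)
  show ?thesis
    using assms symmetric_connected_imp_strongly_connected[OF pair_sym_arcs]
    by unfold_locales (auto simp: bidirected_tree_def not_le)
qed

context bidir_tree
begin

text \<open>A natural-number counterpart of \<open>static_dist\<close>, meaningful for vertices,
  between which a walk always exists.\<close>

definition hop_dist :: "'a \<Rightarrow> 'a \<Rightarrow> nat" where
  "hop_dist u v = (LEAST n. \<exists>p. awalk u p v \<and> length p = n)"

lemma hop_dist_le: "awalk u p v \<Longrightarrow> hop_dist u v \<le> length p"
  unfolding hop_dist_def by (rule Least_le) blast

lemma shortest_awalk:
  assumes "u \<in> pverts G" "v \<in> pverts G"
  obtains p where "awalk u p v" "length p = hop_dist u v"
proof -
  obtain q where "awalk u q v"
    using strongly_connected assms by (auto simp: strongly_connected_def reachable_awalk)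
  then have "\<exists>p. awalk u p v \<and> length p = hop_dist u v"
    unfolding hop_dist_def using LeastI_ex[of "\<lambda>n. \<exists>p. awalk u p v \<and> length p = n"] by blast
  then show ?thesis using that by blast
qed

text \<open>A repeated vertex would allow a closed piece to be cut out, leaving a shorter
  walk.\<close>

lemma shortest_apath:
  assumes "u \<in> pverts G" "v \<in> pverts G"
  obtains p where "apath u p v" "length p = hop_dist u v"
proof -
  obtain p where p: "awalk u p v" "length p = hop_dist u v"
    using shortest_awalk assms by blast
  have "distinct (awalk_verts u p)"
  proof (rule ccontr)
    assume "\<not> distinct (awalk_verts u p)"
    then obtain q s t w where "p = q @ s @ t" "0 < length s" "awalk u q w" "awalk w t v"
      using awalk_not_distinct_decomp[OF p(1)] by blast
    then have "awalk u (q @ t) v" "length (q @ t) < length p"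
      using awalk_appendI by auto
    then show False using hop_dist_le[of u "q @ t" v] p(2) by simp
  qed
  then show ?thesis using that p by (simp add: apath_def)
qed

lemma hop_dist_eq_0_iff:
  assumes "u \<in> pverts G" "v \<in> pverts G"
  shows "hop_dist u v = 0 \<longleftrightarrow> u = v"
proof
  assume "hop_dist u v = 0"
  then show "u = v" using shortest_awalk[OF assms] awalk_empty_ends by (metis length_0_conv)
next
  assume "u = v"
  then show "hop_dist u v = 0" using hop_dist_le[of u "[]" v] assms by (simp add: awalk_Nil_iff)
qed

lemma static_dist_eq_hop_dist:
  assumes "u \<in> pverts G" "v \<in> pverts G"
  shows "static_dist G u v = ereal (hop_dist u v)"
proof -
  have cost: "awalk_cost (\<lambda>_. 1) p = length p" for p
    by (induction p) auto
  obtain p where p: "awalk u p v" "length p = hop_dist u v"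
    using shortest_awalk assms by blast
  have "\<mu> (\<lambda>_. 1) u v = ereal (hop_dist u v)"
    unfolding \<mu>_def
    by (rule antisym) (use p hop_dist_le in \<open>auto simp: cost intro!: INF_greatest INF_lower2[of p]\<close>)
  then show ?thesis by (simp add: static_dist_def)
qed

lemma hop_dist_on_shortest_awalk:
  assumes "awalk u p v" "length p = hop_dist u v" "x \<in> set (awalk_verts u p)" "x \<noteq> v"
  shows "hop_dist u x < hop_dist u v"
proof -
  have "\<exists>q s. p = q @ s \<and> awalk u q x \<and> awalk x s v"
    using assms by (intro awalk_decomp) auto
  then obtain q s where "p = q @ s" "awalk u q x" "awalk x s v"
    by blast
  with assms hop_dist_le[of u q x] show ?thesis
    by (cases s) (auto simp: awalk_Nil_iff)
qed

section \<open>Separation, parents and depths\<close>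

text \<open>A walk from \<open>a\<close> to \<open>c\<close> that misses \<open>b\<close> could be
  closed up through \<open>b\<close> to a cycle of length at least 3.\<close>

lemma neighbours_separated:
  assumes "(a, b) \<in> parcs G" "(b, c) \<in> parcs G" "a \<noteq> c" "awalk a p c"
  shows "b \<in> set (awalk_verts a p)"
proof (rule ccontr)
  assume b: "b \<notin> set (awalk_verts a p)"
  \<comment> \<open>Shortcutting makes the vertices distinct, as \<open>cycle\<close> demands. At
    least one arc survives because \<open>a \<noteq> c\<close>; the two arcs at \<open>b\<close>
    bring the length to 3.\<close>
  define q where "q = awalk_to_apath p"
  have q: "apath a q c" "set q \<subseteq> set p"
    unfolding q_def using assms(4) apath_awalk_to_apath awalk_to_apath_subset by auto
  then have "b \<notin> set (awalk_verts a q)"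
    using b assms(4) set_awalk_verts[of a q c] set_awalk_verts[of a p c]
    by (auto simp: apath_def)
  moreover have "q \<noteq> []" using q(1) assms(3) by (auto simp: apath_Nil_iff)
  moreover have arcs: "(b, a) \<in> parcs G" "(c, b) \<in> parcs G"
    using assms arcs_symmetric by blast+
  then have "awalk b ((b, a) # q @ [(c, b)]) b"
    using q(1) by (auto simp: awalk_Cons_iff awalk_Nil_iff apath_def dest: wellformed')
  moreover from this have "awalk_verts b ((b, a) # q @ [(c, b)]) = b # awalk_verts a q @ [b]"
    by (auto simp: awalk_Cons_iff awalk_verts_append)
  ultimately have "cycle ((b, a) # q @ [(c, b)])" "length ((b, a) # q @ [(c, b)]) \<ge> 3"
    using q(1) by (auto simp: cycle_def apath_def Suc_le_eq)
  then show False using cycle_length not_le by blast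
qed

text \<open>Shortest walks from \<open>r\<close> to \<open>a\<close> and to \<open>c\<close> avoid
  \<open>b\<close>, which is not closer to \<open>r\<close> than their ends. Joined at
  \<open>r\<close>, they would connect two neighbours of \<open>b\<close> without passing
  \<open>b\<close>. The inequalities are weak so that neighbours of equal depth can be ruled out as
  well.\<close>

lemma unique_parent:
  assumes "r \<in> pverts G" "(a, b) \<in> parcs G" "(c, b) \<in> parcs G"
    and "hop_dist r a \<le> hop_dist r b" "hop_dist r c \<le> hop_dist r b"
  shows "a = c"
proof (rule ccontr)
  assume "a \<noteq> c"
  have avoid: "\<exists>p. awalk r p x \<and> b \<notin> set (awalk_verts r p)"
    if x: "(x, b) \<in> parcs G" "hop_dist r x \<le> hop_dist r b" for x
  proof -
    have "x \<in> pverts G" using x(1) by (rule in_arcsD1)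
    then obtain p where p: "awalk r p x" "length p = hop_dist r x"
      using shortest_awalk assms(1) by blast
    have "b \<noteq> x" using x(1) no_loops' by blast
    then have "b \<notin> set (awalk_verts r p)"
      using hop_dist_on_shortest_awalk[OF p, of b] x(2) by auto
    with p(1) show ?thesis by blast
  qed
  obtain p q where pq: "awalk r p a" "b \<notin> set (awalk_verts r p)"
      "awalk r q c" "b \<notin> set (awalk_verts r q)"
    using avoid[OF assms(2,4)] avoid[OF assms(3,5)] by blast
  then have rev: "awalk a (rev_path p) r" "b \<notin> set (awalk_verts a (rev_path p))"
    by (auto simp: awalk_verts_rev_path)
  then have "awalk a (rev_path p @ q) c" "b \<notin> set (awalk_verts a (rev_path p @ q))"
    using pq awalk_appendI set_awalk_verts_append[OF rev(1) pq(3)] by auto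
  then show False
    using neighbours_separated[OF assms(2) arcs_symmetric[OF assms(3)] \<open>a \<noteq> c\<close>] by blast
qed

lemma parent_exists:
  assumes "r \<in> pverts G" "b \<in> pverts G" "b \<noteq> r"
  obtains a where "(a, b) \<in> parcs G" "hop_dist r a < hop_dist r b"
proof -
  obtain p where p: "awalk r p b" "length p = hop_dist r b"
    using shortest_awalk assms by blast
  then have "p \<noteq> []" using assms(3) by (auto simp: awalk_Nil_iff)
  then obtain q a b' where q: "p = q @ [(a, b')]" by (metis rev_exhaust surj_pair)
  with p have "(a, b) \<in> parcs G" "awalk r q a"
    by (auto simp: awalk_Cons_iff awalk_Nil_iff)
  then show ?thesis using that[of a] hop_dist_le[of r q a] p(2) q by auto
qed

lemma hop_dist_arc_le:
  assumes "r \<in> pverts G" "(a, b) \<in> parcs G"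
  shows "hop_dist r b \<le> Suc (hop_dist r a)"
proof -
  obtain p where "awalk r p a" "length p = hop_dist r a"
    using shortest_awalk assms wellformed' by blast
  then show ?thesis
    using hop_dist_le[of r "p @ [(a, b)]" b] assms
    by (auto simp: awalk_Cons_iff awalk_Nil_iff dest: wellformed')
qed

text \<open>Depths of neighbours differ by at most 1. If they were equal, \<open>b\<close> would not
  be the root, and \<open>a\<close> would be a neighbour of \<open>b\<close> no deeper than
  \<open>b\<close> but different from its parent.\<close>

lemma hop_dist_arc_cases:
  assumes "r \<in> pverts G" "(a, b) \<in> parcs G"
  obtains (away) "hop_dist r b = Suc (hop_dist r a)" | (towards) "hop_dist r a = Suc (hop_dist r b)"
proof -
  have "hop_dist r a \<noteq> hop_dist r b"
  proof
    assume eq: "hop_dist r a = hop_dist r b"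
    have ab: "a \<in> pverts G" "b \<in> pverts G" "a \<noteq> b"
      using assms(2) wellformed' no_loops' by auto
    then have "b \<noteq> r"
      using eq assms(1) hop_dist_eq_0_iff[of r a] hop_dist_eq_0_iff[of r b] by auto
    then obtain c where "(c, b) \<in> parcs G" "hop_dist r c < hop_dist r b"
      using parent_exists assms(1) ab(2) by blast
    then show False using unique_parent[of r a b c] assms eq by auto
  qed
  then show ?thesis
    using hop_dist_arc_le[OF assms] hop_dist_arc_le[OF assms(1) arcs_symmetric[OF assms(2)]] that
    by linarith
qed

section \<open>Branching vertices and their neighbours\<close>

lemma degrees_eq_card_neighbours:
  "in_degree (with_proj G) v = card {w. (v, w) \<in> parcs G}"
  "out_degree (with_proj G) v = card {w. (v, w) \<in> parcs G}"
proof -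
  have "in_arcs (with_proj G) v = (\<lambda>w. (w, v)) ` {w. (v, w) \<in> parcs G}"
    by (auto simp: in_arcs_def image_iff intro: arcs_symmetric)
  then show "in_degree (with_proj G) v = card {w. (v, w) \<in> parcs G}"
    by (simp add: in_degree_def card_image inj_on_def)
  have "out_arcs (with_proj G) v = (\<lambda>w. (v, w)) ` {w. (v, w) \<in> parcs G}"
    by (auto simp: out_arcs_def)
  then show "out_degree (with_proj G) v = card {w. (v, w) \<in> parcs G}"
    by (simp add: out_degree_def card_image inj_on_def)
qed

lemma finite_neighbours: "finite {w. (v, w) \<in> parcs G}"
  by (rule finite_subset[OF _ pair_finite_verts]) (auto dest: wellformed')

text \<open>Indegree and outdegree both count the neighbours, so total degree 6 means three
  neighbours.\<close>

lemma branching_vertex_iff: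
  "branching_vertex G v \<longleftrightarrow> v \<in> pverts G \<and> 3 \<le> card {w. (v, w) \<in> parcs G}"
  by (auto simp: branching_vertex_def degrees_eq_card_neighbours)

lemma branching_vertexI:
  assumes "(v, a) \<in> parcs G" "(v, b) \<in> parcs G" "(v, c) \<in> parcs G" "a \<noteq> b" "b \<noteq> c" "a \<noteq> c"
  shows "branching_vertex G v"
proof -
  have "card {a, b, c} \<le> card {w. (v, w) \<in> parcs G}"
    using assms by (intro card_mono finite_neighbours) auto
  then show ?thesis
    using assms by (auto simp: branching_vertex_iff dest: wellformed')
qed

lemma branching_vertex_other_neighbours:
  assumes "branching_vertex G v"
  obtains a b where "(v, a) \<in> parcs G" "(v, b) \<in> parcs G" "a \<noteq> b" "a \<noteq> w" "b \<noteq> w"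
proof -
  have "card {w. (v, w) \<in> parcs G} - 1 \<le> card ({w. (v, w) \<in> parcs G} - {w})"
    using diff_card_le_card_Diff[of "{w}" "{w. (v, w) \<in> parcs G}"] by simp
  then have "2 \<le> card ({w. (v, w) \<in> parcs G} - {w})"
    using assms unfolding branching_vertex_iff by linarith
  then obtain S where "S \<subseteq> {w. (v, w) \<in> parcs G} - {w}" "card S = 2"
    by (meson obtain_subset_with_card_n)
  then show ?thesis using that by (auto simp: card_2_iff)
qed

section \<open>Labelings that permit travel without waiting\<close>

text \<open>The local form of realizability: for periodic labelings it is equivalent to all fastest
  durations being at most the distances. The condition \<open>a \<noteq> c\<close> excludes turning
  back, which no path does.\<close>

definition waitless :: "nat \<Rightarrow> ('a \<times> 'a \<Rightarrow> nat) \<Rightarrow> bool" where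
  "waitless \<Delta> lab \<longleftrightarrow>
     (\<forall>a b c. (a, b) \<in> parcs G \<longrightarrow> (b, c) \<in> parcs G \<longrightarrow> a \<noteq> c \<longrightarrow>
        [lab (b, c) = lab (a, b) + 1] (mod \<Delta>))"

lemma waitlessD:
  assumes "waitless \<Delta> lab" "(a, b) \<in> parcs G" "(b, c) \<in> parcs G" "a \<noteq> c"
  shows "[lab (b, c) = lab (a, b) + 1] (mod \<Delta>)"
  using assms unfolding waitless_def by blast

lemma waitless_apath:
  assumes "waitless \<Delta> lab" "apath u p v" "i < length p"
  shows "[lab (p ! i) = lab (hd p) + i] (mod \<Delta>)"
  using assms(2,3)
proof (induction p arbitrary: u i)
  case (Cons e p)
  show ?case
  proof (cases i)
    case (Suc j)
    then obtain e' p' where p: "p = e' # p'" using Cons.prems by (cases p) auto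
    \<comment> \<open>Distinctness of the path's vertices excludes turning back, so the local
      condition applies to \<open>e\<close> and \<open>e'\<close>.\<close>
    have "e \<in> parcs G" "e' \<in> parcs G" "snd e = fst e'" "fst e \<noteq> snd e'"
      using Cons.prems unfolding p by (auto simp: apath_Cons_iff hd_in_awalk_verts)
    then have "[lab e' = lab e + 1] (mod \<Delta>)"
      using waitlessD[OF assms(1), of "fst e" "snd e" "snd e'"] by (metis prod.collapse)
    moreover have "[lab (p ! j) = lab e' + j] (mod \<Delta>)"
      using Cons.IH[of "snd e" j] Cons.prems Suc p by (auto simp: apath_Cons_iff)
    ultimately have "[lab (p ! j) = lab e + 1 + j] (mod \<Delta>)"
      by (meson cong_add_rcancel_nat cong_trans)
    then show ?thesis by (simp add: Suc)
  qed simp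
qed simp

lemma fastest_duration_le_hop_dist:
  assumes "periodic_labeling G \<Delta> lab" "waitless \<Delta> lab"
    and "u \<in> pverts G" "v \<in> pverts G" "u \<noteq> v"
  shows "fastest_duration G \<Delta> lab u v \<le> enat (hop_dist u v)"
proof -
  obtain p where p: "apath u p v" "length p = hop_dist u v"
    using shortest_apath assms by blast
  \<comment> \<open>The traveller departs at the first active time of the first arc and takes one
    arc of a shortest path per time unit.\<close>
  define s where "s = lab (hd p)"
  define P where "P = zip p [s ..< s + length p]"
  have "p \<noteq> []" using p assms(5) by (auto simp: apath_Nil_iff)
  then have "P \<noteq> []" by (simp add: P_def)
  have fst: "map fst P = p" and snd: "map snd P = [s ..< s + length p]"
    by (simp_all add: P_def)
  have "active_at \<Delta> lab e t" if et: "(e, t) \<in> set P" for e t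
  proof -
    obtain i where i: "i < length p" "e = p ! i" "t = s + i"
      using et unfolding P_def in_set_zip by auto
    then have "e \<in> parcs G" using p(1) by (auto simp: apath_def awalk_def)
    then show ?thesis
      using assms(1) waitless_apath[OF assms(2) p(1) i(1)] i
      by (simp add: active_at_iff periodic_labeling_def s_def)
  qed
  then have "temporal_path G \<Delta> lab u P v"
    using \<open>P \<noteq> []\<close> p(1) unfolding temporal_path_def fst snd by auto
  moreover have "duration P = length p"
    using \<open>P \<noteq> []\<close> \<open>p \<noteq> []\<close> snd
    by (simp add: duration_def flip: hd_map last_map)
  ultimately show ?thesis
    using p(2) by (auto simp: fastest_duration_le_iff)
qed

text \<open>A fastest path from \<open>a\<close> to \<open>c\<close> has duration at most 2, hence
  at most two arcs, and must pass \<open>b\<close>. So it consists of the two given arcs, used at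
  consecutive times.\<close>

lemma waitless_if_fastest_duration_le:
  assumes "periodic_labeling G \<Delta> lab"
    and le: "\<And>u v. u \<in> pverts G \<Longrightarrow> v \<in> pverts G \<Longrightarrow> u \<noteq> v \<Longrightarrow>
      fastest_duration G \<Delta> lab u v \<le> enat (hop_dist u v)"
  shows "waitless \<Delta> lab"
  unfolding waitless_def
proof (intro allI impI)
  fix a b c assume ab: "(a, b) \<in> parcs G" and bc: "(b, c) \<in> parcs G" and "a \<noteq> c"
  have "awalk a [(a, b), (b, c)] c"
    using ab bc by (auto simp: awalk_Cons_iff awalk_Nil_iff dest: wellformed')
  from hop_dist_le[OF this] have "hop_dist a c \<le> 2" by simp
  moreover have "fastest_duration G \<Delta> lab a c \<le> enat (hop_dist a c)"
    using le[OF in_arcsD1[OF ab] in_arcsD2[OF bc] \<open>a \<noteq> c\<close>] .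
  ultimately obtain P where P: "temporal_path G \<Delta> lab a P c" "duration P \<le> 2"
    unfolding fastest_duration_le_iff using order_trans by blast
  then have len: "length P \<le> 2" using length_le_duration[OF P(1)] by simp
  have path: "awalk a (map fst P) c" using P(1) by (auto simp: temporal_path_def apath_def)
  have b: "b \<in> set (awalk_verts a (map fst P))"
    using neighbours_separated[OF ab bc \<open>a \<noteq> c\<close> path] by simp
  have "a \<noteq> b" "b \<noteq> c" using ab bc no_loops' by auto
  obtain e t e' t' where P_eq: "P = [(e, t), (e', t')]"
  proof (cases P)
    case Nil
    then show ?thesis using path \<open>a \<noteq> c\<close> by (simp add: awalk_Nil_iff)
  next
    case (Cons x Q)
    show ?thesis
    proof (cases Q)
      case Nil
      then show ?thesis
        using path b Cons \<open>a \<noteq> b\<close> \<open>b \<noteq> c\<close> by (auto simp: awalk_Cons_iff awalk_Nil_iff)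
    next
      case (Cons y R)
      then show ?thesis using that[of "fst x" "snd x" "fst y" "snd y"] len \<open>P = x # Q\<close> by auto
    qed
  qed
  then have "e = (a, b)" "e' = (b, c)"
    using path b \<open>a \<noteq> b\<close> \<open>b \<noteq> c\<close> by (auto simp: awalk_Cons_iff awalk_Nil_iff prod_eq_iff)
  moreover have "t' = t + 1"
    \<comment> \<open>Strict increase gives \<open>t < t'\<close>, and
      \<open>t' + 1 - t \<le> 2\<close> leaves no gap.\<close>
    using P unfolding P_eq by (auto simp: temporal_path_def duration_def)
  ultimately have "active_at \<Delta> lab (a, b) t" "active_at \<Delta> lab (b, c) (t + 1)"
    using P(1) unfolding P_eq by (auto simp: temporal_path_def)
  then have "[lab (a, b) = t] (mod \<Delta>)" "[lab (b, c) = t + 1] (mod \<Delta>)"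
    using assms(1) ab bc by (auto simp: active_at_iff periodic_labeling_def)
  then show "[lab (b, c) = lab (a, b) + 1] (mod \<Delta>)"
    by (meson cong_add_rcancel_nat cong_sym cong_trans)
qed

section \<open>Necessity of the divisibility\<close>

text \<open>Turning back at \<open>v\<close> is not constrained directly, but two further neighbours
  \<open>a\<close> and \<open>b\<close> link the labels: (\<open>v\<close>, \<open>w\<close>) and
  (\<open>v\<close>, \<open>b\<close>) both follow (\<open>a\<close>, \<open>v\<close>), and
  (\<open>v\<close>, \<open>b\<close>) also follows (\<open>w\<close>, \<open>v\<close>).\<close>

lemma waitless_branching_vertex:
  assumes "waitless \<Delta> lab" "branching_vertex G v" "(v, w) \<in> parcs G"
  shows "[lab (v, w) = lab (w, v) + 1] (mod \<Delta>)"
proof -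
  obtain a b where ab: "(v, a) \<in> parcs G" "(v, b) \<in> parcs G" "a \<noteq> b" "a \<noteq> w" "b \<noteq> w"
    using branching_vertex_other_neighbours assms(2) by blast
  then have "[lab (v, b) = lab (a, v) + 1] (mod \<Delta>)" "[lab (v, w) = lab (a, v) + 1] (mod \<Delta>)"
    "[lab (v, b) = lab (w, v) + 1] (mod \<Delta>)"
    using waitlessD[OF assms(1)] assms(3) arcs_symmetric by blast+
  then show ?thesis by (meson cong_sym cong_trans)
qed

text \<open>On the round trip from \<open>y\<close> to \<open>z\<close> and back, the label grows by
  1 at each inner vertex and at both turning points, \<open>2 * hop_dist y z\<close> times in all,
  and returns to its initial value.\<close>

lemma waitless_imp_dvd:
  assumes "waitless \<Delta> lab" "branching_vertex G y" "branching_vertex G z"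
  shows "\<Delta> dvd 2 * hop_dist y z"
proof (cases "y = z")
  case True
  then show ?thesis
    using assms hop_dist_eq_0_iff[of z z] by (simp add: branching_vertex_def)
next
  case False
  obtain p where p: "apath y p z" "length p = hop_dist y z"
    using shortest_apath assms unfolding branching_vertex_def by blast
  then have "p \<noteq> []" using False by (auto simp: apath_Nil_iff)
  \<comment> \<open>The number of increments between the first and the last arc, one less than the
    distance.\<close>
  define n where "n = length p - 1"
  have n: "n < length p" "hop_dist y z = n + 1"
    using \<open>p \<noteq> []\<close> by (simp_all add: n_def flip: p(2))
  obtain y' where hd: "hd p = (y, y')" and y': "(y, y') \<in> parcs G"
    using p(1) \<open>p \<noteq> []\<close> by (cases p) (auto simp: apath_Cons_iff)
  obtain z' where last: "last p = (z', z)" and z': "(z', z) \<in> parcs G"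
    using p(1) \<open>p \<noteq> []\<close>
    by (cases p rule: rev_cases) (auto simp: apath_def awalk_Cons_iff awalk_Nil_iff)
  have rev: "apath z (rev_path p) y" using p(1) by simp
  have rev_hd: "hd (rev_path p) = (z, z')"
    using last \<open>p \<noteq> []\<close> by (cases p rule: rev_cases) auto
  have rev_last: "last (rev_path p) = (y', y)"
    using hd \<open>p \<noteq> []\<close> by (cases p) auto
  have len: "length (rev_path p) = length p" by (induction p) auto
  have "[lab (z', z) = lab (y, y') + n] (mod \<Delta>)"
    using waitless_apath[OF assms(1) p(1) n(1)] hd last \<open>p \<noteq> []\<close>
    by (simp add: last_conv_nth n_def)
  moreover have "[lab (y', y) = lab (z, z') + n] (mod \<Delta>)"
  proof -
    have "rev_path p ! n = (y', y)"
      using rev_last len \<open>p \<noteq> []\<close> by (simp add: last_conv_nth n_def)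
    then show ?thesis
      using waitless_apath[OF assms(1) rev, of n] n(1) rev_hd len by simp
  qed
  moreover have "[lab (y, y') = lab (y', y) + 1] (mod \<Delta>)" "[lab (z, z') = lab (z', z) + 1] (mod \<Delta>)"
    using waitless_branching_vertex[OF assms(1)] assms(2,3) y' arcs_symmetric[OF z'] by simp_all
  \<comment> \<open>The first congruence is the way back with the turn at \<open>y\<close>. The
    second is the way out with the turn at \<open>z\<close>, shifted by \<open>n + 1\<close> so that
    the two chain.\<close>
  ultimately have "[lab (y, y') = lab (z, z') + n + 1] (mod \<Delta>)"
    "[lab (z, z') + (n + 1) = lab (y, y') + n + 1 + (n + 1)] (mod \<Delta>)"
    by (meson cong_add_rcancel_nat cong_trans)+
  then have "[lab (y, y') + 0 = lab (y, y') + 2 * (n + 1)] (mod \<Delta>)"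
    by (simp add: cong_def mult_2 add.assoc)
  then show ?thesis
    unfolding cong_add_lcancel_nat n(2) by (rule cong_sym[THEN cong_0_iff[THEN iffD1]])
qed

section \<open>Sufficiency: labels from depths in the rooted tree\<close>

text \<open>The reduction is done over the integers because arcs towards \<open>r\<close> carry
  negative depths, which \<open>nat\<close> alone would truncate to 0.\<close>

definition rooted_label :: "nat \<Rightarrow> 'a \<Rightarrow> 'a \<times> 'a \<Rightarrow> nat" where
  "rooted_label \<Delta> r = (\<lambda>(u, v).
     nat ((if hop_dist r u < hop_dist r v then int (hop_dist r v) else - int (hop_dist r v)) mod int \<Delta>))"

lemma periodic_labeling_rooted_label:
  assumes "\<Delta> > 0"
  shows "periodic_labeling G \<Delta> (rooted_label \<Delta> r)"
  using assms by (auto simp: periodic_labeling_def rooted_label_def nat_less_iff)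

lemma waitless_rooted_label:
  assumes "\<Delta> > 0" "r \<in> pverts G"
    and dvd: "\<And>b. branching_vertex G b \<Longrightarrow> \<Delta> dvd 2 * hop_dist r b"
  shows "waitless \<Delta> (rooted_label \<Delta> r)"
  unfolding waitless_def
proof (intro allI impI)
  fix a b c assume ab: "(a, b) \<in> parcs G" and bc: "(b, c) \<in> parcs G" and "a \<noteq> c"
  define L where "L u v =
    (if hop_dist r u < hop_dist r v then int (hop_dist r v) else - int (hop_dist r v))" for u v
  have lab: "[int (rooted_label \<Delta> r (u, v)) = L u v] (mod int \<Delta>)" for u v
    using assms(1) by (simp add: rooted_label_def L_def cong_def)
  have cb: "(c, b) \<in> parcs G" using bc arcs_symmetric by blast
  have "[L b c = L a b + 1] (mod int \<Delta>)"
    using assms(2) ab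
  proof (cases rule: hop_dist_arc_cases)
    case away
    \<comment> \<open>Here \<open>a\<close> is the parent of \<open>b\<close>, so every other
      neighbour of \<open>b\<close> is a child: a step away from \<open>r\<close> is never followed
      by one towards \<open>r\<close>.\<close>
    then have "\<not> hop_dist r c \<le> hop_dist r b"
      using unique_parent[OF assms(2) ab cb] \<open>a \<noteq> c\<close> by auto
    then have "hop_dist r c = Suc (hop_dist r b)"
      using hop_dist_arc_le[OF assms(2) bc] by simp
    then show ?thesis using away by (simp add: L_def)
  next
    case towards
    show ?thesis
      using assms(2) bc
    proof (cases rule: hop_dist_arc_cases)
      case away
      \<comment> \<open>Both \<open>a\<close> and \<open>c\<close> are children of \<open>b\<close>,
        the critical case. The two sides of the goal differ by exactly this number.\<close>
      have "\<Delta> dvd 2 * hop_dist r b"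
      proof (cases "b = r")
        case True
        then show ?thesis using assms(2) hop_dist_eq_0_iff[of r r] by simp
      next
        case False
        then obtain d where "(d, b) \<in> parcs G" "hop_dist r d < hop_dist r b"
          using parent_exists assms(2) in_arcsD2[OF ab] by blast
        \<comment> \<open>The parent \<open>d\<close> differs from \<open>a\<close> and
          \<open>c\<close>, since it is less deep than \<open>b\<close> and they are deeper.\<close>
        then have "branching_vertex G b"
          using towards away bc \<open>a \<noteq> c\<close> arcs_symmetric[OF ab] arcs_symmetric
          by (intro branching_vertexI[of b a c d]) (simp, simp, blast, auto)
        then show ?thesis by (rule dvd)
      qed
      then have "int \<Delta> dvd 2 * int (hop_dist r b)"
        by (metis int_dvd_int_iff of_nat_mult of_nat_numeral)
      then show ?thesis using away towards by (simp add: L_def cong_iff_dvd_diff)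
    qed (use towards in \<open>simp add: L_def\<close>)
  qed
  then have "[int (rooted_label \<Delta> r (b, c)) = int (rooted_label \<Delta> r (a, b)) + 1] (mod int \<Delta>)"
    using lab cong_trans cong_sym cong_add_rcancel by meson
  then show "[rooted_label \<Delta> r (b, c) = rooted_label \<Delta> r (a, b) + 1] (mod \<Delta>)"
    by (simp flip: cong_int_iff add: add.commute)
qed

section \<open>The equivalence and its translation to half-integer multiples\<close>

lemma realizable_static_dist_iff_dvd:
  assumes "\<Delta> > 0"
    and D: "\<And>u v. u \<in> pverts G \<Longrightarrow> v \<in> pverts G \<Longrightarrow> u \<noteq> v \<Longrightarrow> D u v = enat (hop_dist u v)"
  shows "realizable G D \<Delta> \<longleftrightarrow>
    (\<forall>y z. branching_vertex G y \<and> branching_vertex G z \<longrightarrow> \<Delta> dvd 2 * hop_dist y z)"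
proof
  assume "realizable G D \<Delta>"
  then obtain lab where "periodic_labeling G \<Delta> lab"
    "\<forall>u \<in> pverts G. \<forall>v \<in> pverts G. u \<noteq> v \<longrightarrow> fastest_duration G \<Delta> lab u v \<le> D u v"
    unfolding realizable_def by blast
  then have "waitless \<Delta> lab"
    using waitless_if_fastest_duration_le[of \<Delta> lab] D by simp
  then show "\<forall>y z. branching_vertex G y \<and> branching_vertex G z \<longrightarrow> \<Delta> dvd 2 * hop_dist y z"
    using waitless_imp_dvd by blast
next
  assume dvd: "\<forall>y z. branching_vertex G y \<and> branching_vertex G z \<longrightarrow> \<Delta> dvd 2 * hop_dist y z"
  \<comment> \<open>A branching root gets the divisibility from the assumption. Without branching
    vertices it holds vacuously, and any vertex of the nonempty graph serves.\<close>
  obtain r where "r \<in> pverts G" "\<And>b. branching_vertex G b \<Longrightarrow> \<Delta> dvd 2 * hop_dist r b"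
  proof (cases "\<exists>r. branching_vertex G r")
    case True
    then show ?thesis using that dvd unfolding branching_vertex_def by blast
  next
    case False
    then show ?thesis using that strongly_connected by (auto simp: strongly_connected_def)
  qed
  then have "waitless \<Delta> (rooted_label \<Delta> r)"
    using waitless_rooted_label assms(1) by blast
  then show "realizable G D \<Delta>"
    unfolding realizable_def
    using fastest_duration_le_hop_dist periodic_labeling_rooted_label[OF assms(1)] D by metis
qed

end

lemma half_integer_multiple_iff_dvd:
  "(\<exists>k::int. real n = of_int k * (real m / 2)) \<longleftrightarrow> m dvd 2 * n"
proof
  assume "\<exists>k::int. real n = of_int k * (real m / 2)"
  then obtain k :: int where "real n = of_int k * (real m / 2)" ..
  then have "real_of_int (int (2 * n)) = real_of_int (k * int m)" by simp
  then have "int (2 * n) = k * int m" by (simp only: of_int_eq_iff)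
  then show "m dvd 2 * n" by (metis dvd_triv_right int_dvd_int_iff)
next
  assume "m dvd 2 * n"
  then obtain k where "2 * n = m * k" ..
  then have "2 * real n = real m * real k" by (metis of_nat_mult of_nat_numeral)
  then have "real n = of_int (int k) * (real m / 2)" by (simp add: field_simps)
  then show "\<exists>k::int. real n = of_int k * (real m / 2)" ..
qed

theorem mainTheorem3:
  fixes G :: "'a pair_pre_digraph" and D :: "'a \<Rightarrow> 'a \<Rightarrow> enat" and \<Delta> :: nat
  assumes "dittr_instance G D \<Delta>"
    and "\<And>u v. u \<in> pverts G \<Longrightarrow> v \<in> pverts G \<Longrightarrow> u \<noteq> v \<Longrightarrow>
           ereal_of_enat (D u v) = static_dist G u v"
  shows "realizable G D \<Delta> \<longleftrightarrow>
    (\<forall>y z. branching_vertex G y \<and> branching_vertex G z \<longrightarrow>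
       (\<exists>k::int. static_dist G y z = ereal (of_int k * (real \<Delta> / 2))))"
proof -
  interpret bidir_tree G
    using assms(1) by (intro bidirected_tree_bidir_tree) (simp add: dittr_instance_def)
  \<comment> \<open>The static distance is finite, which excludes the value
    \<open>\<infinity>\<close> for \<open>D u v\<close>.\<close>
  have "D u v = enat (hop_dist u v)" if "u \<in> pverts G" "v \<in> pverts G" "u \<noteq> v" for u v
    using assms(2)[OF that] static_dist_eq_hop_dist[OF that(1,2)] by (cases "D u v") auto
  moreover have "\<Delta> > 0" using assms(1) by (simp add: dittr_instance_def)
  ultimately have "realizable G D \<Delta> \<longleftrightarrow>
      (\<forall>y z. branching_vertex G y \<and> branching_vertex G z \<longrightarrow> \<Delta> dvd 2 * hop_dist y z)"
    by (intro realizable_static_dist_iff_dvd)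
  also have "\<dots> \<longleftrightarrow> (\<forall>y z. branching_vertex G y \<and> branching_vertex G z \<longrightarrow>
       (\<exists>k::int. static_dist G y z = ereal (of_int k * (real \<Delta> / 2))))"
    by (auto simp: branching_vertex_def static_dist_eq_hop_dist
        simp flip: half_integer_multiple_iff_dvd)
  finally show ?thesis .
qed

end
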